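(* Let $C$ be the clique complex of a finite simple undirected graph, let $d\ge 0$ be an integer, and let $C_d=\{\alpha_1,\dots,\alpha_k\}$ be its set of $d$-faces, enumerated without repetition in non-decreasing order of a positive weight function on $C_d$. For $0\le i\le k$ let $C_d^i=\{\alpha_1,\dots,\alpha_i\}$ (so $C_d^0=\emptyset$). Let $1\le i\le k$ and let $\alpha\in C_d^i$ be a neighbour of $\alpha_i$ with respect to $C_d^i$ (so in particular $\alpha\neq\alpha_i$ and $\alpha\in C_d^{i-1}$). Let $\mathrm{F}^{i}(\alpha)$ and $\mathrm{F}^{i-1}(\alpha)$ denote the Forman-Ricci curvatures of $\alpha$ with respect to $C_d^{i}$ and $C_d^{i-1}$, respectively. If $\alpha$ is a parallel neighbour of $\alpha_i$ with respect to $C_d^i$, then $$\mathrm{F}^i(\alpha)=\mathrm{F}^{i-1}(\alpha)-1.$$ Otherwise, $$\mathrm{F}^i(\alpha)=\mathrm{F}^{i-1}(\alpha)+(d+1).$$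
   Context: The clique complex $C=\bigcup_d C_d$ of a graph is the set of all non-empty vertex sets of its complete subgraphs. A $d$-face is such a vertex set with $d+1$ elements, and $C_d$ is the set of all $d$-faces. The boundary $\partial(\alpha)$ of a $d$-face $\alpha$ is the set of all $(d-1)$-faces contained in $\alpha$; write $\gamma<\alpha$ if $\gamma\in\partial(\alpha)$. The following notions are taken with respect to $C_d^j$, for $0\le j\le k$. A $(d+1)$-face $\beta\in C_{d+1}$ is present with respect to $C_d^j$ if all of the $d$-faces in its boundary belong to $C_d^j$. Two distinct faces $\sigma,\tau\in C_d^j$ are neighbours with respect to $C_d^j$ if at least one of the following holds: (1) there is a $(d-1)$-face $\gamma$ with $\gamma<\sigma$ and $\gamma<\tau$; (2) there is a $(d+1)$-face $\beta$, present with respect to $C_d^j$, with $\sigma<\beta$ and $\tau<\beta$. They are parallel neighbours with respect to $C_d^j$ if (1) holds but (2) does not. For $\alpha\in C_d^j$, let $H_\alpha^j$ be the set of $(d+1)$-faces present with respect to $C_d^j$ that contain $\alpha$ in their boundary, and let $P_\alpha^j$ be the set of parallel neighbours of $\alpha$ with respect to $C_d^j$. The Forman-Ricci curvature of $\alpha$ with respect to $C_d^j$ is $$\mathrm{F}^j(\alpha)=|H_\alpha^j|+(d+1)-|P_\alpha^j|.$$ *)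

theory Defs
  imports Complex_Main "HOL-Library.Ramsey"
begin

definition finite_simple_graph :: "'a set \<Rightarrow> 'a set set \<Rightarrow> bool" where
  "finite_simple_graph V E \<longleftrightarrow> finite V \<and> E \<subseteq> [V]\<^bsup>2\<^esup>"

definition clique_complex :: "'a set \<Rightarrow> 'a set set \<Rightarrow> 'a set set" where
  "clique_complex V E = {A. A \<subseteq> V \<and> A \<noteq> {} \<and> clique A E}"

definition faces :: "'a set set \<Rightarrow> nat \<Rightarrow> 'a set set" where
  "faces C d = {A \<in> C. card A = d + 1}"

(* The empty set is not a member of a clique complex, so the boundary of a
   0-face is empty.  The dimensions are compared without subtraction because
   d - 1 would be 0 for d = 0. *)
definition boundary :: "'a set set \<Rightarrow> 'a set \<Rightarrow> 'a set set" where
  "boundary C \<alpha> = {\<gamma> \<in> C. \<gamma> \<subseteq> \<alpha> \<and> card \<alpha> = card \<gamma> + 1}"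

lemma boundary_faces_0:
  assumes "clique_complex V E = C" "finite V" "\<alpha> \<in> faces C 0"
  shows "boundary C \<alpha> = {}"
  using assms by (auto simp: boundary_def faces_def clique_complex_def dest: finite_subset)

lemma boundary_faces_Suc:
  assumes "\<alpha> \<in> faces C (Suc d)"
  shows "boundary C \<alpha> = {\<gamma> \<in> faces C d. \<gamma> \<subseteq> \<alpha>}"
  using assms by (auto simp: boundary_def faces_def)

(* In the following notions, S is the set of d-faces with respect to which they are taken. *)

definition present :: "'a set set \<Rightarrow> nat \<Rightarrow> 'a set set \<Rightarrow> 'a set \<Rightarrow> bool" where
  "present C d S \<beta> \<longleftrightarrow> \<beta> \<in> faces C (d + 1) \<and> boundary C \<beta> \<subseteq> S"

definition lower_adjacent :: "'a set set \<Rightarrow> 'a set \<Rightarrow> 'a set \<Rightarrow> bool" where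
  "lower_adjacent C \<sigma> \<tau> \<longleftrightarrow> (\<exists>\<gamma>. \<gamma> \<in> boundary C \<sigma> \<and> \<gamma> \<in> boundary C \<tau>)"

definition upper_adjacent :: "'a set set \<Rightarrow> nat \<Rightarrow> 'a set set \<Rightarrow> 'a set \<Rightarrow> 'a set \<Rightarrow> bool" where
  "upper_adjacent C d S \<sigma> \<tau> \<longleftrightarrow>
     (\<exists>\<beta>. present C d S \<beta> \<and> \<sigma> \<in> boundary C \<beta> \<and> \<tau> \<in> boundary C \<beta>)"

definition neighbours :: "'a set set \<Rightarrow> nat \<Rightarrow> 'a set set \<Rightarrow> 'a set \<Rightarrow> 'a set \<Rightarrow> bool" where
  "neighbours C d S \<sigma> \<tau> \<longleftrightarrow>
     \<sigma> \<in> S \<and> \<tau> \<in> S \<and> \<sigma> \<noteq> \<tau> \<and> (lower_adjacent C \<sigma> \<tau> \<or> upper_adjacent C d S \<sigma> \<tau>)"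

definition parallel_neighbours :: "'a set set \<Rightarrow> nat \<Rightarrow> 'a set set \<Rightarrow> 'a set \<Rightarrow> 'a set \<Rightarrow> bool" where
  "parallel_neighbours C d S \<sigma> \<tau> \<longleftrightarrow>
     \<sigma> \<in> S \<and> \<tau> \<in> S \<and> \<sigma> \<noteq> \<tau> \<and> lower_adjacent C \<sigma> \<tau> \<and> \<not> upper_adjacent C d S \<sigma> \<tau>"

definition present_cofaces :: "'a set set \<Rightarrow> nat \<Rightarrow> 'a set set \<Rightarrow> 'a set \<Rightarrow> 'a set set" where
  "present_cofaces C d S \<alpha> = {\<beta>. present C d S \<beta> \<and> \<alpha> \<in> boundary C \<beta>}"

definition parallel_set :: "'a set set \<Rightarrow> nat \<Rightarrow> 'a set set \<Rightarrow> 'a set \<Rightarrow> 'a set set" where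
  "parallel_set C d S \<alpha> = {\<tau>. parallel_neighbours C d S \<tau> \<alpha>}"

definition forman_ricci :: "'a set set \<Rightarrow> nat \<Rightarrow> 'a set set \<Rightarrow> 'a set \<Rightarrow> int" where
  "forman_ricci C d S \<alpha> =
     int (card (present_cofaces C d S \<alpha>)) + (int d + 1) - int (card (parallel_set C d S \<alpha>))"

(* In an enumeration a 1, ..., a k of the d-faces, the first j of them; empty for j = 0. *)
definition initial_faces :: "(nat \<Rightarrow> 'a set) \<Rightarrow> nat \<Rightarrow> 'a set set" where
  "initial_faces a j = a ` {1..j}"

lemma neighbours_last_in_previous:
  assumes "1 \<le> i" "neighbours C d (initial_faces a i) \<alpha> (a i)"
  shows "\<alpha> \<noteq> a i" "\<alpha> \<in> initial_faces a (i - 1)"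
proof -
  show ne: "\<alpha> \<noteq> a i"
    using assms by (simp add: neighbours_def)
  obtain j where "j \<in> {1..i}" "\<alpha> = a j"
    using assms unfolding neighbours_def initial_faces_def by blast
  with ne show "\<alpha> \<in> initial_faces a (i - 1)"
    unfolding initial_faces_def by (cases "j = i") auto
qed

end

(* Let x be the last face and \<alpha> a neighbour of x.  A present coface of \<alpha> is lost on removing x
   exactly if it contains x, and the only face that can contain both is \<alpha> \<union> x.
   If \<alpha> and x are parallel, no coface changes and x is the only parallel neighbour lost.
   Otherwise \<alpha> \<union> x is the only coface lost, and the parallel neighbours gained are the
   other d of the d + 2 faces in its boundary. *)
theory Submission
  imports Defs
begin

lemma finite_clique_complex:
  assumes "finite V"
  shows "finite (clique_complex V E)"
  using assms by (auto simp: clique_complex_def intro: finite_subset[of _ "Pow V"])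

lemma clique_complex_subset:
  assumes "A \<in> clique_complex V E" "B \<subseteq> A" "B \<noteq> {}"
  shows "B \<in> clique_complex V E"
  using assms by (auto simp: clique_complex_def clique_def)

text \<open>Both faces have one element fewer than \<open>\<beta>\<close>. Being distinct and of
  equal size, neither contains the other, so their union is larger than \<open>\<sigma>\<close> and
  already fills \<open>\<beta>\<close>. Hence two distinct faces have at most one common
  coface.\<close>

lemma face_eq_union_of_boundary:
  assumes \<beta>: "\<beta> \<in> faces C n"
    and \<sigma>: "\<sigma> \<in> boundary C \<beta>" and \<tau>: "\<tau> \<in> boundary C \<beta>" and "\<sigma> \<noteq> \<tau>"
  shows "\<beta> = \<sigma> \<union> \<tau>"
proof -
  have fin: "finite \<beta>"
    using \<beta> by (auto simp: faces_def intro: card_ge_0_finite)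
  have sub: "\<sigma> \<subseteq> \<beta>" "\<tau> \<subseteq> \<beta>" and card: "card \<beta> = card \<sigma> + 1" "card \<beta> = card \<tau> + 1"
    using \<sigma> \<tau> by (auto simp: boundary_def)
  have fin': "finite \<sigma>" "finite \<tau>"
    using sub fin by (auto intro: finite_subset)
  have "\<not> \<tau> \<subseteq> \<sigma>"
    using card_subset_eq[OF fin'(1)] card \<open>\<sigma> \<noteq> \<tau>\<close> by auto
  then have "card \<sigma> < card (\<sigma> \<union> \<tau>)"
    using fin' by (intro psubset_card_mono) auto
  then show ?thesis
    using card_seteq[OF fin, of "\<sigma> \<union> \<tau>"] sub card by auto
qed

text \<open>A clique complex is closed under nonempty subsets, so every subset of
  \<open>\<beta>\<close> with \<open>d + 1\<close> elements is a face. There are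
  \<open>d + 2\<close> of these, one for each omitted vertex.\<close>

lemma card_boundary:
  assumes "C = clique_complex V E" "\<beta> \<in> faces C (d + 1)"
  shows "card (boundary C \<beta>) = d + 2"
proof -
  have \<beta>: "\<beta> \<in> C" "card \<beta> = d + 2"
    using assms(2) by (auto simp: faces_def)
  then have fin: "finite \<beta>"
    by (auto intro: card_ge_0_finite)
  have "\<gamma> \<in> C" if "\<gamma> \<subseteq> \<beta>" "card \<gamma> = d + 1" for \<gamma>
    using that \<beta> assms(1) by (auto intro: clique_complex_subset)
  then have "boundary C \<beta> = {\<gamma>. \<gamma> \<subseteq> \<beta> \<and> card \<gamma> = d + 1}"
    using \<beta> by (auto simp: boundary_def)
  then show ?thesis
    using n_subsets[OF fin, of "d + 1"] \<beta>(2) binomial_symmetric[of "d + 1" "d + 2"] by simp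
qed

text \<open>The shared lower face is \<open>\<sigma> \<inter> \<tau>\<close>, of size (d + 1) + (d +
  1) - (d + 2) = d. For d = 0 this intersection is empty and hence not in the complex, which is why
  d must be positive.\<close>

lemma lower_adjacent_if_boundary:
  assumes C: "C = clique_complex V E" and "0 < d" and \<beta>: "\<beta> \<in> faces C (d + 1)"
    and \<sigma>: "\<sigma> \<in> boundary C \<beta>" and \<tau>: "\<tau> \<in> boundary C \<beta>" and "\<sigma> \<noteq> \<tau>"
  shows "lower_adjacent C \<sigma> \<tau>"
proof -
  have card: "card \<beta> = d + 2" "card \<sigma> = d + 1" "card \<tau> = d + 1"
    using \<beta> \<sigma> \<tau> by (auto simp: faces_def boundary_def)
  then have fin: "finite \<sigma>" "finite \<tau>"
    by (auto intro: card_ge_0_finite)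
  have "card (\<sigma> \<inter> \<tau>) = d"
    using card_Un_Int[OF fin] face_eq_union_of_boundary[OF \<beta> \<sigma> \<tau> \<open>\<sigma> \<noteq> \<tau>\<close>] card by simp
  moreover have "\<sigma> \<inter> \<tau> \<in> C"
    using \<sigma> calculation \<open>0 < d\<close> C
    by (auto simp: boundary_def intro: clique_complex_subset[of \<sigma>])
  ultimately show ?thesis
    using card unfolding lower_adjacent_def boundary_def by auto
qed

lemma present_remove:
  "present C d (S - {x}) \<beta> \<longleftrightarrow> present C d S \<beta> \<and> x \<notin> boundary C \<beta>"
  by (auto simp: present_def)

lemma upper_adjacent_sym:
  "upper_adjacent C d S \<sigma> \<tau> \<longleftrightarrow> upper_adjacent C d S \<tau> \<sigma>"
  by (auto simp: upper_adjacent_def)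

lemma lower_adjacent_sym:
  "lower_adjacent C \<sigma> \<tau> \<longleftrightarrow> lower_adjacent C \<tau> \<sigma>"
  by (auto simp: lower_adjacent_def)

lemma parallel_neighbours_sym:
  "parallel_neighbours C d S \<sigma> \<tau> \<longleftrightarrow> parallel_neighbours C d S \<tau> \<sigma>"
  by (auto simp: parallel_neighbours_def upper_adjacent_sym lower_adjacent_sym)

lemma finite_parallel_set:
  assumes "finite S"
  shows "finite (parallel_set C d S \<alpha>)"
  using assms by (rule finite_subset[rotated]) (auto simp: parallel_set_def parallel_neighbours_def)

lemma finite_present_cofaces:
  assumes "finite C"
  shows "finite (present_cofaces C d S \<alpha>)"
  using assms
  by (rule finite_subset[rotated]) (auto simp: present_cofaces_def present_def faces_def)

lemma forman_ricci_parallel_neighbour: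
  assumes fin: "finite S" and par: "parallel_neighbours C d S \<alpha> x"
  shows "forman_ricci C d S \<alpha> = forman_ricci C d (S - {x}) \<alpha> - 1"
proof -
  have no: "x \<notin> boundary C \<beta>" if "present C d S \<beta>" "\<alpha> \<in> boundary C \<beta>" for \<beta>
    using par that by (auto simp: parallel_neighbours_def upper_adjacent_def)
  have cofaces: "present_cofaces C d S \<alpha> = present_cofaces C d (S - {x}) \<alpha>"
    using no by (auto simp: present_cofaces_def present_remove)
  \<comment> \<open>Lower adjacency does not refer to \<open>S\<close>. Once upper adjacency to
    \<open>\<alpha>\<close> is unchanged as well, the parallel neighbours can differ only in
    \<open>x\<close> itself.\<close>
  have "upper_adjacent C d (S - {x}) \<tau> \<alpha> \<longleftrightarrow> upper_adjacent C d S \<tau> \<alpha>" for \<tau>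
    using no by (auto simp: upper_adjacent_def present_remove)
  then have "parallel_set C d S \<alpha> = insert x (parallel_set C d (S - {x}) \<alpha>)"
    using par parallel_neighbours_sym[of C d S \<alpha> x]
    by (auto simp: parallel_set_def parallel_neighbours_def)
  moreover have "x \<notin> parallel_set C d (S - {x}) \<alpha>"
    by (simp add: parallel_set_def parallel_neighbours_def)
  ultimately have "card (parallel_set C d S \<alpha>) = card (parallel_set C d (S - {x}) \<alpha>) + 1"
    using finite_parallel_set[of "S - {x}"] fin by simp
  then show ?thesis
    by (simp add: forman_ricci_def cofaces)
qed

lemma forman_ricci_upper_adjacent:
  assumes C: "C = clique_complex V E" and "finite V" and fin: "finite S"
    and "\<alpha> \<noteq> x" and up: "upper_adjacent C d S \<alpha> x"
  shows "forman_ricci C d S \<alpha> = forman_ricci C d (S - {x}) \<alpha> + (int d + 1)"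
proof -
  obtain \<beta> where \<beta>: "present C d S \<beta>" "\<alpha> \<in> boundary C \<beta>" "x \<in> boundary C \<beta>"
    using up by (auto simp: upper_adjacent_def)
  then have face: "\<beta> \<in> faces C (d + 1)" and bd: "boundary C \<beta> \<subseteq> S"
    by (auto simp: present_def)
  \<comment> \<open>Both cofaces equal \<open>\<alpha> \<union> \<tau>\<close>. The face
    \<open>\<tau>\<close> is kept general: \<open>\<tau> = x\<close> settles which cofaces are lost,
    and \<open>\<tau> \<in> N\<close> below settles which parallel neighbours are gained.\<close>
  have uniq: "\<beta>' = \<beta>"
    if "present C d S \<beta>'" "\<alpha> \<in> boundary C \<beta>'" "\<tau> \<in> boundary C \<beta>'" "\<tau> \<in> boundary C \<beta>" "\<tau> \<noteq> \<alpha>"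
    for \<beta>' \<tau>
    using that \<beta> face face_eq_union_of_boundary[of _ C "d + 1" \<alpha> \<tau>] by (auto simp: present_def)
  have iff: "present C d S \<beta>' \<and> \<alpha> \<in> boundary C \<beta>' \<longleftrightarrow>
      present C d (S - {x}) \<beta>' \<and> \<alpha> \<in> boundary C \<beta>' \<or> \<beta>' = \<beta>" for \<beta>'
    using uniq[of \<beta>' x] \<beta> \<open>\<alpha> \<noteq> x\<close> by (auto simp: present_remove)

  have "present_cofaces C d S \<alpha> = insert \<beta> (present_cofaces C d (S - {x}) \<alpha>)"
    using iff by (auto simp: present_cofaces_def)
  moreover have "\<beta> \<notin> present_cofaces C d (S - {x}) \<alpha>"
    using \<beta> by (simp add: present_cofaces_def present_remove)
  moreover have "finite C"
    using C \<open>finite V\<close> by (simp add: finite_clique_complex)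
  ultimately have cofaces:
    "card (present_cofaces C d S \<alpha>) = card (present_cofaces C d (S - {x}) \<alpha>) + 1"
    using finite_present_cofaces[of C] by simp

  define N where "N = boundary C \<beta> - {\<alpha>, x}"
  have cardN: "card N = d"
    using card_boundary[OF C face] \<beta> \<open>\<alpha> \<noteq> x\<close> by (simp add: N_def card_Diff_subset)
  have finN: "finite N"
    using bd fin by (auto simp: N_def intro: finite_subset)
  have N_lower: "lower_adjacent C \<tau> \<alpha>" if "\<tau> \<in> N" for \<tau>
  proof (rule lower_adjacent_if_boundary[OF C _ face])
    \<comment> \<open>For d = 0 the set \<open>N\<close> is empty, so an element of \<open>N\<close>
      rules this case out.\<close>
    show "0 < d"
      using that cardN finN card_gt_0_iff[of N] by auto
  qed (use that \<beta> in \<open>auto simp: N_def\<close>)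
  have upper_iff: "upper_adjacent C d S \<tau> \<alpha> \<longleftrightarrow>
      upper_adjacent C d (S - {x}) \<tau> \<alpha> \<or> \<tau> \<in> boundary C \<beta>" for \<tau>
    using iff unfolding upper_adjacent_def by metis
  \<comment> \<open>By \<open>uniq\<close>, a coface joining \<open>\<tau>\<close> and
    \<open>\<alpha>\<close> could only be \<open>\<beta>\<close>, which is no longer present without
    \<open>x\<close>.\<close>
  have N_not_upper: "\<not> upper_adjacent C d (S - {x}) \<tau> \<alpha>" if "\<tau> \<in> N" for \<tau>
    using that uniq[of _ \<tau>] \<beta>(3)
    unfolding N_def upper_adjacent_def present_remove by blast

  have "\<tau> \<in> parallel_set C d (S - {x}) \<alpha> \<longleftrightarrow> \<tau> \<in> parallel_set C d S \<alpha> \<or> \<tau> \<in> N" for \<tau>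
  proof (cases "\<tau> \<in> N")
    case True
    then show ?thesis
      using N_lower N_not_upper bd \<beta> \<open>\<alpha> \<noteq> x\<close>
      by (auto simp: parallel_set_def parallel_neighbours_def N_def)
  next
    case False
    \<comment> \<open>Outside \<open>N\<close>, the boundary of \<open>\<beta>\<close> leaves only
      \<open>\<alpha>\<close> and \<open>x\<close>. The first is never its own neighbour; the second
      is upper adjacent to \<open>\<alpha>\<close> in \<open>S\<close> and absent from
      \<open>S - {x}\<close>, so it is parallel in neither.\<close>
    then show ?thesis
      using upper_iff[of \<tau>] \<beta> \<open>\<alpha> \<noteq> x\<close>
      by (auto simp: parallel_set_def parallel_neighbours_def N_def)
  qed
  then have "parallel_set C d (S - {x}) \<alpha> = parallel_set C d S \<alpha> \<union> N"
    by blast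
  \<comment> \<open>With respect to \<open>S\<close>, the coface \<open>\<beta>\<close> makes every
    face in \<open>N\<close> upper adjacent to \<open>\<alpha>\<close>.\<close>
  moreover have "parallel_set C d S \<alpha> \<inter> N = {}"
    using upper_iff unfolding parallel_set_def parallel_neighbours_def N_def by blast
  ultimately have "card (parallel_set C d (S - {x}) \<alpha>) = card (parallel_set C d S \<alpha>) + d"
    using card_Un_disjoint[OF finite_parallel_set[OF fin] finN] cardN by metis
  \<comment> \<open>Passing from \<open>S - {x}\<close> to \<open>S\<close>, the extra coface
    contributes 1 and the \<open>d\<close> parallel neighbours that disappear contribute
    \<open>d\<close>.\<close>
  then show ?thesis
    by (simp add: forman_ricci_def cofaces)
qed

theorem proposition1:
  fixes V :: "'a set" and E :: "'a set set" and C :: "'a set set"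
    and d k i :: nat
    and a :: "nat \<Rightarrow> 'a set" and w :: "'a set \<Rightarrow> real"
    and \<alpha> :: "'a set"
  assumes graph: "finite_simple_graph V E"
    and C: "C = clique_complex V E"
    and weight_pos: "\<And>\<sigma>. \<sigma> \<in> faces C d \<Longrightarrow> w \<sigma> > 0"
    and enum: "bij_betw a {1..k} (faces C d)"
    and weight_mono: "mono_on {1..k} (\<lambda>j. w (a j))"
    and i: "1 \<le> i" "i \<le> k"
    and \<alpha>: "\<alpha> \<in> initial_faces a i"
    and nb: "neighbours C d (initial_faces a i) \<alpha> (a i)"
  shows "(parallel_neighbours C d (initial_faces a i) \<alpha> (a i) \<longrightarrow>
            forman_ricci C d (initial_faces a i) \<alpha>
              = forman_ricci C d (initial_faces a (i - 1)) \<alpha> - 1) \<and>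
         (\<not> parallel_neighbours C d (initial_faces a i) \<alpha> (a i) \<longrightarrow>
            forman_ricci C d (initial_faces a i) \<alpha>
              = forman_ricci C d (initial_faces a (i - 1)) \<alpha> + (int d + 1))"
proof -
  let ?S = "initial_faces a i"
  have inj: "inj_on a {1..i}"
    using enum i(2) by (auto simp: bij_betw_def intro: inj_on_subset)
  have "{1..i - 1} = {1..i} - {i}"
    using i(1) by auto
  \<comment> \<open>Without repetitions in the enumeration, dropping the index \<open>i\<close>
    removes exactly the face \<open>a i\<close>.\<close>
  then have prev: "initial_faces a (i - 1) = ?S - {a i}"
    using inj_on_image_set_diff[OF inj, of "{1..i}" "{i}"] i(1)
    by (simp add: initial_faces_def)
  have "finite ?S"
    by (simp add: initial_faces_def)
  moreover have "finite V"
    using graph by (simp add: finite_simple_graph_def)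
  \<comment> \<open>A neighbour that is lower adjacent but not parallel must be upper adjacent; one
    that is not lower adjacent is upper adjacent by definition.\<close>
  moreover have "\<alpha> \<noteq> a i" "upper_adjacent C d ?S \<alpha> (a i)"
    if "\<not> parallel_neighbours C d ?S \<alpha> (a i)"
    using nb that by (auto simp: neighbours_def parallel_neighbours_def)
  ultimately show ?thesis
    unfolding prev
    using forman_ricci_parallel_neighbour forman_ricci_upper_adjacent[OF C] by blast
qed

end
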